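(* Let $v:\{0,1\}^d\to\mathbb{R}$ be a cooperative game. Let $z_1,z_2,\dots$ be independent samples from the normalized Shapley-kernel distribution $p$, and let $\beta^*=(\phi_1(v),\dots,\phi_d(v))$ be the vector of Shapley values of $v$. Then: (i) if $v$ has bounded value, both the original KernelSHAP estimator $\hat\beta_n$ and the unbiased KernelSHAP estimator $\bar\beta_n$ are consistent: $\lim_{n\to\infty}\hat\beta_n=\lim_{n\to\infty}\bar\beta_n=\beta^*$ almost surely; (ii) $\bar\beta_n$ is unbiased: $\mathbb{E}[\bar\beta_n]=\beta^*$.
   Context: Let $D=\{1,\dots,d\}$, $d\ge2$. A cooperative game $v$ assigns a real number to each $S\subseteq D$; subsets are identified with $z\in\{0,1\}^d$ via $S=\{i:z_i=1\}$. $\mathbf 0,\mathbf 1$ are the all-zeros and all-ones vectors in $\mathbb{R}^d$. The Shapley values are $$\phi_i(v)=\frac1d\sum_{S\subseteq D\setminus\{i\}}\binom{d-1}{|S|}^{-1}\big(v(S\cup\{i\})-v(S)\big).$$ Distribution $p$ on $\{0,1\}^d$: $p(z)\propto \dfrac{d-1}{\binom{d}{k}k(d-k)}$ with $k=\mathbf 1^Tz$ when $0<k<d$, and $p(z)=0$ otherwise. $Z$ denotes a random vector with law $p$, and $A=\mathbb{E}[ZZ^T]$. For a $d\times d$ matrix $M$ and $c\in\mathbb{R}^d$ put $$\mathcal B(M,c)=M^{-1}\Big(c-\mathbf 1\,\frac{\mathbf 1^TM^{-1}c-v(\mathbf 1)+v(\mathbf 0)}{\mathbf 1^TM^{-1}\mathbf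 1}\Big).$$ Original KernelSHAP: $\hat A_n=\frac1n\sum_{i=1}^nz_iz_i^T$, $\hat b_n=\frac1n\sum_{i=1}^nz_i(v(z_i)-v(\mathbf 0))$, $\hat\beta_n=\mathcal B(\hat A_n,\hat b_n)$. Unbiased KernelSHAP: $\bar b_n=\frac1n\sum_{i=1}^nz_iv(z_i)-\mathbb{E}[Z]\,v(\mathbf 0)$, $\bar\beta_n=\mathcal B(A,\bar b_n)$. *)

theory Defs
  imports "HOL-Probability.Probability"
begin

text \<open>
  Players are the elements of a finite type \<open>'n\<close>, with \<open>d = CARD('n)\<close>.
  Coalitions are sets of players; \<open>indvec\<close> is the identification of coalitions with
  vectors in \<open>{0,1}\<^sup>d\<close>, so \<open>v(\<one>)\<close> is \<open>v UNIV\<close> and \<open>v(\<zero>)\<close> is \<open>v {}\<close>.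
\<close>

type_synonym 'n game = "'n set \<Rightarrow> real"

definition indvec :: "'n::finite set \<Rightarrow> real ^ 'n" where
  "indvec S = (\<chi> i. if i \<in> S then 1 else 0)"

definition outer :: "real ^ 'n \<Rightarrow> real ^ 'm \<Rightarrow> real ^ 'm ^ 'n" where
  "outer x y = (\<chi> i j. x $ i * y $ j)"

definition shapley_values :: "'n::finite game \<Rightarrow> real ^ 'n" where
  "shapley_values v = (\<chi> i. 1 / real CARD('n) *
     (\<Sum>S\<in>Pow (UNIV - {i}).
        inverse (real ((CARD('n) - 1) choose card S)) * (v (S \<union> {i}) - v S)))"

definition shapley_weight :: "'n::finite set \<Rightarrow> real" where
  "shapley_weight S =
    (let d = CARD('n); k = card S in
      if 0 < k \<and> k < d
      then (real d - 1) / (real (d choose k) * real k * (real d - real k))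
      else 0)"

text \<open>The normalized weights sum to 1 only if \<open>CARD('n) \<ge> 2\<close>; the law is meaningless otherwise.\<close>

definition shapley_kernel :: "'n::finite set pmf" where
  "shapley_kernel =
    embed_pmf (\<lambda>S. shapley_weight S / (\<Sum>T\<in>UNIV. shapley_weight (T :: 'n set)))"

definition mean_Z :: "real ^ 'n::finite" where
  "mean_Z = measure_pmf.expectation shapley_kernel indvec"

definition second_moment_Z :: "real ^ 'n ^ 'n::finite" where
  "second_moment_Z =
    measure_pmf.expectation shapley_kernel (\<lambda>S. outer (indvec S) (indvec S))"

text \<open>
  For a singular \<open>M\<close>, \<^const>\<open>matrix_inv\<close> returns an unspecified matrix.
\<close>

definition shap_solution :: "'n::finite game \<Rightarrow> real ^ 'n ^ 'n \<Rightarrow> real ^ 'n \<Rightarrow> real ^ 'n" where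
  "shap_solution v M c =
    matrix_inv M *v
      (c - ((1 \<bullet> (matrix_inv M *v c) - v UNIV + v {}) / (1 \<bullet> (matrix_inv M *v 1))) *\<^sub>R 1)"

text \<open>
  In the estimators, \<open>z\<close> is the sequence of sampled coalitions, indexed from 0: the first \<open>n\<close>
  samples are \<open>z 0, \<dots>, z (n - 1)\<close>.
\<close>

definition A_hat :: "(nat \<Rightarrow> 'n::finite set) \<Rightarrow> nat \<Rightarrow> real ^ 'n ^ 'n" where
  "A_hat z n = (1 / real n) *\<^sub>R (\<Sum>i<n. outer (indvec (z i)) (indvec (z i)))"

definition b_hat :: "'n::finite game \<Rightarrow> (nat \<Rightarrow> 'n set) \<Rightarrow> nat \<Rightarrow> real ^ 'n" where
  "b_hat v z n = (1 / real n) *\<^sub>R (\<Sum>i<n. (v (z i) - v {}) *\<^sub>R indvec (z i))"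

definition beta_hat :: "'n::finite game \<Rightarrow> (nat \<Rightarrow> 'n set) \<Rightarrow> nat \<Rightarrow> real ^ 'n" where
  "beta_hat v z n = shap_solution v (A_hat z n) (b_hat v z n)"

definition b_bar :: "'n::finite game \<Rightarrow> (nat \<Rightarrow> 'n set) \<Rightarrow> nat \<Rightarrow> real ^ 'n" where
  "b_bar v z n = (1 / real n) *\<^sub>R (\<Sum>i<n. v (z i) *\<^sub>R indvec (z i)) - v {} *\<^sub>R mean_Z"

definition beta_bar :: "'n::finite game \<Rightarrow> (nat \<Rightarrow> 'n set) \<Rightarrow> nat \<Rightarrow> real ^ 'n" where
  "beta_bar v z n = shap_solution v second_moment_Z (b_bar v z n)"

end

theory Submission imports Defs begin

text \<open>
  For \<open>i \<noteq> j\<close>, the sets containing \<open>i\<close> and not \<open>j\<close> of each size \<open>0 < k < d\<close> have total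
  weight \<open>1 / d\<close>. Hence the probability \<open>g\<close> that \<open>Z\<close> contains \<open>i\<close> and not \<open>j\<close> does not depend
  on \<open>i\<close> and \<open>j\<close>, and \<open>A\<close> is \<open>g\<close> times the identity plus a nonnegative multiple of the all-ones
  matrix. So \<open>A\<close> is invertible, and the constrained least squares solution for \<open>(A, c)\<close> is
  \<open>c / g\<close> with its mean corrected to \<open>(v \<one> - v \<zero>) / d\<close>. This is affine in \<open>c\<close>, which gives
  unbiasedness, and for \<open>c = E[Z (v Z - v \<zero>)]\<close> it agrees with the Shapley values coefficient
  by coefficient. For consistency, Hoeffding's inequality and Borel--Cantelli give the strong law
  for sample averages, and by Cramer's rule the solution depends continuously on \<open>(A, c)\<close>.
\<close>

section \<open>Continuity of the constrained solution in the matrix and the vector\<close>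

lemma matrix_inv_right:
  fixes A :: "real ^ 'n ^ 'n::finite"
  assumes "det A \<noteq> 0"
  shows "A ** matrix_inv A = mat 1"
proof -
  have "\<exists>B. A ** B = mat 1 \<and> B ** A = mat 1"
    using assms invertible_det_nz[of A] by (simp add: invertible_def)
  then show ?thesis
    unfolding matrix_inv_def by (rule someI2_ex) simp
qed

text \<open>Turns the inverse, which is given by a choice operator, into quotients of determinants.
  These are rational in the entries of \<open>A\<close> and \<open>b\<close>, so limits can be taken
  entrywise.\<close>

lemma matrix_inv_vector_cramer:
  fixes A :: "real ^ 'n ^ 'n::finite"
  assumes "det A \<noteq> 0"
  shows "matrix_inv A *v b = (\<chi> k. det (\<chi> i j. if j = k then b $ i else A $ i $ j) / det A)"
proof -
  have "A *v (matrix_inv A *v b) = b"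
    by (simp add: matrix_vector_mul_assoc matrix_inv_right[OF assms])
  then show ?thesis
    using cramer[OF assms] by blast
qed

lemma tendsto_det:
  fixes A :: "real ^ 'n ^ 'n::finite"
  assumes "(M \<longlongrightarrow> A) F"
  shows "((\<lambda>n. det (M n)) \<longlongrightarrow> det A) F"
  unfolding det_def by (intro tendsto_intros assms)

text \<open>Since the determinant is continuous, \<open>M n\<close> is eventually nonsingular and
  Cramer's rule applies to it. The unspecified value of \<open>matrix_inv\<close> at a singular
  \<open>M n\<close> therefore cannot affect the limit. This matters for \<open>A_hat\<close>, which
  is singular when there are few samples.\<close>

lemma tendsto_matrix_inv_vector:
  fixes A :: "real ^ 'n ^ 'n::finite"
  assumes M: "(M \<longlongrightarrow> A) F" and c: "(c \<longlongrightarrow> b) F" and A: "det A \<noteq> 0"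
  shows "((\<lambda>n. matrix_inv (M n) *v c n) \<longlongrightarrow> matrix_inv A *v b) F"
proof -
  have ev: "eventually (\<lambda>n. det (M n) \<noteq> 0) F"
    using tendsto_imp_eventually_ne[OF tendsto_det[OF M] A] .
  have "((\<lambda>n. \<chi> k. det (\<chi> i j. if j = k then c n $ i else M n $ i $ j) / det (M n)) \<longlongrightarrow>
      (\<chi> k. det (\<chi> i j. if j = k then b $ i else A $ i $ j) / det A)) F"
  proof (intro tendsto_vec_lambda tendsto_divide tendsto_det A M)
    fix k i j
    show "((\<lambda>n. if j = k then c n $ i else M n $ i $ j) \<longlongrightarrow>
        (if j = k then b $ i else A $ i $ j)) F"
      using M c by (auto intro: tendsto_vec_nth)
  qed
  then show ?thesis
    unfolding matrix_inv_vector_cramer[OF A]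
    by (rule Lim_transform_eventually)
       (use ev in \<open>auto elim!: eventually_mono simp: matrix_inv_vector_cramer\<close>)
qed

lemma tendsto_shap_solution:
  fixes A :: "real ^ 'n ^ 'n::finite"
  assumes M: "(M \<longlongrightarrow> A) F" and c: "(c \<longlongrightarrow> b) F" and A: "det A \<noteq> 0"
    and nz: "1 \<bullet> (matrix_inv A *v 1) \<noteq> 0"
  shows "((\<lambda>n. shap_solution v (M n) (c n)) \<longlongrightarrow> shap_solution v A b) F"
  unfolding shap_solution_def
  by (intro tendsto_matrix_inv_vector[OF M _ A] tendsto_intros c nz)

section \<open>Strong law of large numbers for samples from a finite set\<close>

lemma (in prob_space) strong_law_bounded:
  fixes X :: "nat \<Rightarrow> 'a \<Rightarrow> real"
  assumes indep: "indep_vars (\<lambda>_. borel) X UNIV"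
    and bdd: "\<And>i. AE x in M. X i x \<in> {a..b}" and "a < b"
    and mean: "\<And>i. expectation (X i) = \<mu>"
  shows "AE x in M. (\<lambda>n. (\<Sum>i<n. X i x) / real n) \<longlonglongrightarrow> \<mu>"
proof -
  have rv [measurable]: "X i \<in> borel_measurable M" for i
    using indep unfolding indep_vars_def by blast
  define B where "B e n = {x \<in> space M. \<bar>(\<Sum>i<n. X i x) - real n * \<mu>\<bar> \<ge> real n * e}"
    for e :: real and n
  have [measurable]: "B e n \<in> sets M" for e n
    unfolding B_def by measurable
  \<comment> \<open>The \<open>n\<close> variables have common width \<open>b - a\<close>, so
    Hoeffding's exponent is linear in \<open>n\<close> and the tail bound is geometric, hence
    summable. For \<open>n = 0\<close> the squared widths sum to zero, but the claimed bound is then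
    2 and holds trivially.\<close>
  have bound: "prob (B e n) \<le> 2 * exp (- 2 * e\<^sup>2 / (b - a)\<^sup>2) ^ n" if "e > 0" for e n
  proof (cases "n = 0")
    case True
    then show ?thesis using prob_le_1[of "B e n"] by (simp del: prob_le_1)
  next
    case False
    interpret H: Hoeffding_ineq M "{..<n}" X "\<lambda>_. a" "\<lambda>_. b" "\<Sum>i<n. expectation (X i)"
      by unfold_locales (use bdd in \<open>auto intro: indep_vars_subset[OF indep]\<close>)
    have "prob (B e n) \<le> 2 * exp (- 2 * (real n * e)\<^sup>2 / (\<Sum>i<n. (b - a)\<^sup>2))"
      using H.Hoeffding_ineq_abs_ge[of "real n * e"] that \<open>a < b\<close> False
      by (simp add: B_def mean)
    also have "- 2 * (real n * e)\<^sup>2 / (\<Sum>i<n. (b - a)\<^sup>2) = real n * (- 2 * e\<^sup>2 / (b - a)\<^sup>2)"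
      using False by (simp add: power2_eq_square)
    finally show ?thesis
      by (simp only: exp_of_nat_mult)
  qed
  have "AE x in M. eventually (\<lambda>n. x \<in> space M - B e n) sequentially" if "e > 0" for e
  proof (rule borel_cantelli_AE1)
    have "exp (- 2 * e\<^sup>2 / (b - a)\<^sup>2) < 1"
      using that \<open>a < b\<close> by simp
    then have "summable (\<lambda>n. 2 * exp (- 2 * e\<^sup>2 / (b - a)\<^sup>2) ^ n)"
      by (intro summable_mult summable_geometric) simp
    then show "summable (\<lambda>n. prob (B e n))"
      by (rule summable_comparison_test') (use bound[OF that] in simp)
  qed (simp_all add: emeasure_eq_measure)
  \<comment> \<open>Restricting the thresholds to 1 / (m + 1) leaves countably many null sets, so a
    single one serves for all of them.\<close>
  then have "AE x in M. \<forall>m. eventually (\<lambda>n. x \<in> space M - B (1 / Suc m) n) sequentially"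
    by (subst AE_all_countable) simp
  then show ?thesis
  proof (rule AE_mp, intro AE_I2 impI)
    fix x assume x: "\<forall>m. eventually (\<lambda>n. x \<in> space M - B (1 / Suc m) n) sequentially"
    show "(\<lambda>n. (\<Sum>i<n. X i x) / real n) \<longlonglongrightarrow> \<mu>"
    proof (rule tendstoI)
      fix e :: real assume "e > 0"
      then obtain m where m: "1 / Suc m < e"
        by (metis nat_approx_posE)
      have "eventually (\<lambda>n. x \<in> space M - B (1 / Suc m) n) sequentially"
        using x by blast
      then show "eventually (\<lambda>n. dist ((\<Sum>i<n. X i x) / real n) \<mu> < e) sequentially"
        using eventually_gt_at_top[of 0]
      proof eventually_elim
        case (elim n)
        then have "\<bar>(\<Sum>i<n. X i x) - real n * \<mu>\<bar> < real n * (1 / Suc m)"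
          by (auto simp: B_def)
        also have "\<dots> < real n * e"
          using m elim by (intro mult_strict_left_mono) auto
        finally have "\<bar>(\<Sum>i<n. X i x) - real n * \<mu>\<bar> / real n < e"
          using elim by (simp add: field_simps)
        moreover have "\<bar>(\<Sum>i<n. X i x) - real n * \<mu>\<bar> / real n = \<bar>(\<Sum>i<n. X i x) / real n - \<mu>\<bar>"
          using elim by (subst abs_div_pos) (simp_all add: diff_divide_distrib)
        ultimately show ?case
          by (simp add: dist_real_def)
      qed
    qed
  qed
qed

lemma (in prob_space) integral_pmf_distr:
  fixes Z :: "'a \<Rightarrow> 's::finite" and f :: "'s \<Rightarrow> 'b::{banach, second_countable_topology}"
  assumes Z: "random_variable (count_space UNIV) Z"
    and distr: "distr M (count_space UNIV) Z = measure_pmf p"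
  shows "integrable M (\<lambda>x. f (Z x))"
    and "integral\<^sup>L M (\<lambda>x. f (Z x)) = measure_pmf.expectation p f"
proof -
  have "integrable (distr M (count_space UNIV) Z) f"
    unfolding distr by (rule integrable_measure_pmf_finite) simp
  then show "integrable M (\<lambda>x. f (Z x))"
    by (subst (asm) integrable_distr_eq[OF Z]) simp_all
  show "integral\<^sup>L M (\<lambda>x. f (Z x)) = measure_pmf.expectation p f"
    by (subst distr[symmetric], subst integral_distr[OF Z]) simp_all
qed

text \<open>The vector-valued case reduces to real indicators: the sample average of
  \<open>f\<close> is the sum over \<open>s\<close> of the observed frequency of \<open>s\<close>
  times \<open>f s\<close>, and each of the finitely many frequencies converges to
  \<open>pmf p s\<close>.\<close>

lemma (in prob_space) strong_law_finite:
  fixes Z :: "nat \<Rightarrow> 'a \<Rightarrow> 's::finite" and f :: "'s \<Rightarrow> 'b::{banach, second_countable_topology}"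
  assumes indep: "indep_vars (\<lambda>_. count_space UNIV) Z UNIV"
    and distr: "\<And>i. distr M (count_space UNIV) (Z i) = measure_pmf p"
  shows "AE x in M. (\<lambda>n. (1 / real n) *\<^sub>R (\<Sum>i<n. f (Z i x))) \<longlonglongrightarrow> measure_pmf.expectation p f"
proof -
  have rv: "Z i \<in> measurable M (count_space UNIV)" for i
    using indep unfolding indep_vars_def by blast
  have "AE x in M. (\<lambda>n. (\<Sum>i<n. indicat_real {s} (Z i x)) / real n) \<longlonglongrightarrow> pmf p s" for s
  proof (rule strong_law_bounded[where a = 0 and b = 1])
    show "indep_vars (\<lambda>_. borel) (\<lambda>i x. indicat_real {s} (Z i x)) UNIV"
      by (rule indep_vars_compose2[OF indep]) simp
    show "expectation (\<lambda>x. indicat_real {s} (Z i x)) = pmf p s" for i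
      using integral_pmf_distr(2)[OF rv[of i] distr[of i], of "indicat_real {s}"]
      by (simp add: pmf.rep_eq)
  qed (auto simp: indicator_def)
  then have "AE x in M. \<forall>s. (\<lambda>n. (\<Sum>i<n. indicat_real {s} (Z i x)) / real n) \<longlonglongrightarrow> pmf p s"
    by (subst AE_all_countable) simp
  then show ?thesis
  proof (rule AE_mp, intro AE_I2 impI)
    fix x assume x: "\<forall>s. (\<lambda>n. (\<Sum>i<n. indicat_real {s} (Z i x)) / real n) \<longlonglongrightarrow> pmf p s"
    have eq: "(1 / real n) *\<^sub>R (\<Sum>i<n. f (Z i x)) =
        (\<Sum>s\<in>UNIV. ((\<Sum>i<n. indicat_real {s} (Z i x)) / real n) *\<^sub>R f s)" for n
    proof -
      have "indicat_real {s} t *\<^sub>R f s = (if s = t then f s else 0)" for s t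
        by (simp add: indicator_def)
      then have "(\<Sum>i<n. f (Z i x)) = (\<Sum>i<n. \<Sum>s\<in>UNIV. indicat_real {s} (Z i x) *\<^sub>R f s)"
        by simp
      also have "\<dots> = (\<Sum>s\<in>UNIV. (\<Sum>i<n. indicat_real {s} (Z i x)) *\<^sub>R f s)"
        by (subst sum.swap) (simp add: scaleR_sum_left)
      finally show ?thesis
        by (simp add: scaleR_sum_right)
    qed
    have "measure_pmf.expectation p f = (\<Sum>s\<in>UNIV. pmf p s *\<^sub>R f s)"
      by (rule integral_measure_pmf) auto
    then show "(\<lambda>n. (1 / real n) *\<^sub>R (\<Sum>i<n. f (Z i x))) \<longlonglongrightarrow> measure_pmf.expectation p f"
      unfolding eq using x by (auto intro!: tendsto_intros)
  qed
qed

section \<open>Total weight of the coalitions that separate two players\<close>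

lemma one_inner_vec: "(1 :: real ^ 'n::finite) \<bullet> x = (\<Sum>i\<in>UNIV. x $ i)"
  by (simp add: inner_vec_def)

text \<open>Grouped by size, the subsets of each size from 0 to \<open>card U\<close> contribute
  exactly 1, because their number is the binomial coefficient being inverted.\<close>

lemma sum_Pow_inverse_binomial:
  assumes "finite U"
  shows "(\<Sum>T\<in>Pow U. inverse (real (card U choose card T))) = real (card U + 1)"
proof -
  have "(\<Sum>T\<in>Pow U. inverse (real (card U choose card T))) =
      (\<Sum>k\<in>{..card U}. \<Sum>T | T \<in> Pow U \<and> card T = k. inverse (real (card U choose card T)))"
    by (rule sum.group[symmetric]) (use assms in \<open>auto intro: card_mono\<close>)
  also have "\<dots> = (\<Sum>k\<in>{..card U}. 1)"
  proof (rule sum.cong[OF refl])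
    fix k assume "k \<in> {..card U}"
    then show "(\<Sum>T | T \<in> Pow U \<and> card T = k. inverse (real (card U choose card T))) = 1"
      using n_subsets[OF assms, of k] by simp
  qed
  finally show ?thesis by simp
qed

lemma shapley_weight_nonneg: "shapley_weight S \<ge> 0"
  by (auto simp: shapley_weight_def Let_def)

text \<open>
  With $k = |S|$, the weight is $1 / (d \binom{d-2}{k-1})$, since
  $\binom{d}{k} k (d-k) = d (d-1) \binom{d-2}{k-1}$.
\<close>
lemma shapley_weight_insert:
  fixes T :: "'n::finite set"
  assumes "i \<noteq> j" and T: "T \<subseteq> UNIV - {i, j}"
  shows "shapley_weight (insert i T) =
    inverse (real (card (UNIV - {i, j}) choose card T)) / real CARD('n)"
proof -
  define m where "m = card (UNIV - {i, j})"
  have d: "CARD('n) = m + 2"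
    using card_Diff_subset[of "{i, j}" UNIV] card_mono[of UNIV "{i, j}"] \<open>i \<noteq> j\<close>
    by (auto simp: m_def)
  have le: "card T \<le> m"
    unfolding m_def using T by (intro card_mono) auto
  have k: "card (insert i T) = card T + 1"
    using T by (subst card_insert_disjoint) auto
  have "(card T + 1) * ((m + 2) choose (card T + 1)) = (m + 2) * ((m + 1) choose card T)"
    using Suc_times_binomial[of "card T" "m + 1"]
    by (simp del: binomial_Suc_Suc mult_Suc mult_Suc_right)
  then have "(card T + 1) * ((m + 2) choose (card T + 1)) * (m + 1 - card T)
      = (m + 2) * ((m + 1 - card T) * ((m + 1) choose card T))"
    by (simp only: mult_ac)
  also have "\<dots> = (m + 2) * ((m + 1) * (m choose card T))"
    using binomial_absorb_comp[of "m + 1" "card T"] by simp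
  finally have eq: "real ((card T + 1) * ((m + 2) choose (card T + 1)) * (m + 1 - card T)) =
      real ((m + 2) * ((m + 1) * (m choose card T)))"
    by (rule arg_cong)
  have diff: "real (m + 1 - card T) = real (m + 2) - real (card T + 1)"
    using le by simp
  from eq have "real ((m + 2) choose (card T + 1)) * real (card T + 1) * (real (m + 2) - real (card T + 1))
      = real (m + 2) * (real (m + 1) * real (m choose card T))"
    unfolding diff[symmetric] by (simp only: of_nat_mult mult_ac)
  then show ?thesis
    using le unfolding shapley_weight_def Let_def d k m_def[symmetric]
    by (simp add: divide_simps)
qed

text \<open>Such coalitions are \<open>insert i T\<close> with \<open>T\<close> avoiding both
  players. By \<open>shapley_weight_insert\<close> their weights are inverse binomials over d - 2
  players, divided by d, and the inverse binomials sum to d - 1.\<close>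

lemma sum_shapley_weight_separating:
  fixes i j :: "'n::finite"
  assumes "i \<noteq> j"
  shows "(\<Sum>S | i \<in> S \<and> j \<notin> S. shapley_weight S) = (real CARD('n) - 1) / real CARD('n)"
proof -
  let ?U = "UNIV - {i, j}"
  have "{S. i \<in> S \<and> j \<notin> S} = insert i ` Pow ?U"
  proof (intro equalityI subsetI)
    fix S assume "S \<in> {S. i \<in> S \<and> j \<notin> S}"
    then have "S = insert i (S - {i})" "S - {i} \<in> Pow ?U" by auto
    then show "S \<in> insert i ` Pow ?U" by blast
  qed (use assms in auto)
  moreover have "inj_on (insert i) (Pow ?U)"
    by (rule inj_onI) (metis Diff_iff PowD insertCI insert_ident subsetD)
  ultimately have "(\<Sum>S | i \<in> S \<and> j \<notin> S. shapley_weight S) =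
      (\<Sum>T\<in>Pow ?U. shapley_weight (insert i T))"
    by (simp add: sum.reindex)
  also have "\<dots> = (\<Sum>T\<in>Pow ?U. inverse (real (card ?U choose card T))) / real CARD('n)"
    by (simp add: shapley_weight_insert[OF assms] sum_divide_distrib)
  also have "(\<Sum>T\<in>Pow ?U. inverse (real (card ?U choose card T))) = real CARD('n) - 1"
    using card_Diff_subset[of "{i, j}" UNIV] card_mono[of UNIV "{i, j}"] assms
    by (subst sum_Pow_inverse_binomial) (auto simp: of_nat_diff)
  finally show ?thesis .
qed

lemma exists_distinct:
  assumes "CARD('n::finite) \<ge> 2"
  shows "\<exists>j::'n. j \<noteq> i"
proof (rule ccontr)
  assume "\<not> ?thesis"
  then have "(UNIV :: 'n set) = {i}" by auto
  then show False using assms by (metis card_1_singleton_iff Suc_1 One_nat_def not_less_eq_eq order_refl)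
qed

text \<open>The coalitions separating two distinct players already have positive total weight. Hence
  the normalization in \<open>shapley_kernel\<close> is legitimate.\<close>

lemma sum_shapley_weight_pos:
  assumes "CARD('n::finite) \<ge> 2"
  shows "(\<Sum>S\<in>UNIV. shapley_weight (S :: 'n set)) > 0"
proof -
  obtain i j :: 'n where "j \<noteq> i"
    using exists_distinct[OF assms] by blast
  then have "0 < (\<Sum>S | j \<in> S \<and> i \<notin> S. shapley_weight S)"
    using assms by (simp add: sum_shapley_weight_separating)
  also have "\<dots> \<le> (\<Sum>S\<in>UNIV. shapley_weight (S :: 'n set))"
    by (rule sum_mono2) (auto simp: shapley_weight_nonneg)
  finally show ?thesis .
qed

lemma pmf_shapley_kernel:
  assumes "CARD('n::finite) \<ge> 2"
  shows "pmf shapley_kernel (S :: 'n set) = shapley_weight S / (\<Sum>T\<in>UNIV. shapley_weight (T :: 'n set))"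
  unfolding shapley_kernel_def
proof (rule pmf_embed_pmf)
  let ?W = "\<Sum>T\<in>UNIV. shapley_weight (T :: 'n set)"
  show nn: "0 \<le> shapley_weight (S :: 'n set) / ?W" for S
    using sum_shapley_weight_pos[OF assms] shapley_weight_nonneg[of S] by simp
  have "(\<integral>\<^sup>+S. ennreal (shapley_weight (S :: 'n set) / ?W) \<partial>count_space UNIV) =
      ennreal (\<Sum>S\<in>UNIV. shapley_weight (S :: 'n set) / ?W)"
    using nn by (subst nn_integral_count_space_finite) (auto simp: sum_ennreal)
  also have "(\<Sum>S\<in>UNIV. shapley_weight (S :: 'n set) / ?W) = 1"
    using sum_shapley_weight_pos[OF assms] by (simp add: sum_divide_distrib[symmetric])
  finally show "(\<integral>\<^sup>+S. ennreal (shapley_weight (S :: 'n set) / ?W) \<partial>count_space UNIV) = 1"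
    by simp
qed

section \<open>The second moment matrix and its constrained solution\<close>

lemma expectation_finite_pmf:
  fixes f :: "'s::finite \<Rightarrow> 'b::{banach, second_countable_topology}"
  shows "measure_pmf.expectation p f = (\<Sum>s\<in>UNIV. pmf p s *\<^sub>R f s)"
  by (rule integral_measure_pmf) auto

text \<open>The probability that \<open>Z\<close> contains \<open>i\<close> and not \<open>j\<close>, the same for all \<open>i \<noteq> j\<close>.\<close>
definition separation_prob :: "'n::finite itself \<Rightarrow> real" where
  "separation_prob _ = (real CARD('n) - 1) /
     (real CARD('n) * (\<Sum>S\<in>UNIV. shapley_weight (S :: 'n set)))"

lemma separation_prob_pos:
  assumes "CARD('n::finite) \<ge> 2"
  shows "separation_prob TYPE('n) > 0"
  using assms sum_shapley_weight_pos[OF assms] by (auto simp: separation_prob_def)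

lemma sum_pmf_separating:
  fixes i j :: "'n::finite"
  assumes d: "CARD('n) \<ge> 2" and "i \<noteq> j"
  shows "(\<Sum>S\<in>UNIV. pmf shapley_kernel S * (if i \<in> S \<and> j \<notin> S then 1 else 0)) =
    separation_prob TYPE('n)"
proof -
  have "(\<Sum>S\<in>UNIV. pmf shapley_kernel S * (if i \<in> S \<and> j \<notin> S then 1 else 0)) =
      (\<Sum>S | i \<in> S \<and> j \<notin> S. pmf shapley_kernel S)"
    by (rule sum.mono_neutral_cong_right) auto
  then show ?thesis
    by (simp add: pmf_shapley_kernel[OF d] sum_divide_distrib[symmetric]
        sum_shapley_weight_separating[OF \<open>i \<noteq> j\<close>] separation_prob_def)
qed

lemma second_moment_Z_nth:
  "second_moment_Z $ i $ j =
    (\<Sum>S\<in>UNIV. pmf shapley_kernel S * (if i \<in> S \<and> j \<in> S then 1 else 0))"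
  unfolding second_moment_Z_def expectation_finite_pmf
  by (simp add: outer_def indvec_def) (rule sum.cong, auto)

text \<open>A coalition containing \<open>i\<close> either contains \<open>j\<close> too or
  separates \<open>i\<close> from \<open>j\<close>.\<close>

lemma second_moment_Z_off_diagonal:
  fixes i j :: "'n::finite"
  assumes "CARD('n) \<ge> 2" and "i \<noteq> j"
  shows "second_moment_Z $ i $ j = second_moment_Z $ i $ i - separation_prob TYPE('n)"
  unfolding second_moment_Z_nth sum_pmf_separating[OF assms, symmetric] sum_subtractf[symmetric]
  by (rule sum.cong) auto

text \<open>By symmetry the (i, j) and (j, i) entries agree, and each lies below its diagonal entry
  by the same separation probability.\<close>

lemma second_moment_Z_diagonal:
  fixes i j :: "'n::finite"
  assumes "CARD('n) \<ge> 2"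
  shows "second_moment_Z $ i $ i = second_moment_Z $ j $ j"
proof (cases "i = j")
  case False
  have "second_moment_Z $ i $ j = second_moment_Z $ j $ i"
    by (simp add: second_moment_Z_nth conj_commute)
  then show ?thesis
    using second_moment_Z_off_diagonal[OF assms False]
      second_moment_Z_off_diagonal[OF assms, of j i] False by simp
qed simp

lemma second_moment_Z_mult_vector:
  assumes "CARD('n::finite) \<ge> 2"
  obtains a where "a \<ge> 0"
    and "\<And>x :: real ^ 'n. second_moment_Z *v x = separation_prob TYPE('n) *\<^sub>R x + (a * (1 \<bullet> x)) *\<^sub>R 1"
proof -
  let ?g = "separation_prob TYPE('n)"
  \<comment> \<open>An arbitrary player serves as reference, since all diagonal entries agree. Then
    \<open>a\<close> is the common off-diagonal entry, a probability and so nonnegative.\<close>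
  define i0 where "i0 = (undefined :: 'n)"
  define a where "a = second_moment_Z $ i0 $ i0 - ?g"
  obtain j0 where "j0 \<noteq> i0"
    using exists_distinct[OF assms] by blast
  then have "a = second_moment_Z $ i0 $ j0"
    using second_moment_Z_off_diagonal[OF assms, of i0 j0] by (simp add: a_def)
  then have "a \<ge> 0"
    by (simp add: second_moment_Z_nth sum_nonneg)
  have entry: "second_moment_Z $ i $ j = (if i = j then ?g else 0) + a" for i j :: 'n
    using second_moment_Z_off_diagonal[OF assms, of i j] second_moment_Z_diagonal[OF assms, of i i0]
    by (cases "i = j") (simp_all add: a_def)
  have "second_moment_Z *v x = ?g *\<^sub>R x + (a * (1 \<bullet> x)) *\<^sub>R 1" for x :: "real ^ 'n"
    by (simp add: vec_eq_iff matrix_vector_mult_def entry one_inner_vec distrib_right sum.distrib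
        sum_distrib_left if_distrib[of "\<lambda>r. r * _"] cong: if_cong)
  with \<open>a \<ge> 0\<close> show thesis
    using that by blast
qed

lemma det_second_moment_Z:
  assumes d: "CARD('n::finite) \<ge> 2"
  shows "det (second_moment_Z :: real ^ 'n ^ 'n) \<noteq> 0"
proof -
  let ?g = "separation_prob TYPE('n)"
  obtain a where a: "a \<ge> 0"
    and A: "\<And>x :: real ^ 'n. second_moment_Z *v x = ?g *\<^sub>R x + (a * (1 \<bullet> x)) *\<^sub>R 1"
    using second_moment_Z_mult_vector[OF d] by blast
  have g: "?g > 0"
    by (rule separation_prob_pos[OF d])
  have "x = 0" if "second_moment_Z *v x = 0" for x :: "real ^ 'n"
  proof -
    have eq: "?g *\<^sub>R x + (a * (1 \<bullet> x)) *\<^sub>R 1 = 0"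
      using that A by simp
    \<comment> \<open>Pairing with the all-ones vector isolates the coordinate sum of
      \<open>x\<close>, multiplied by the positive number g + a d. Once that sum vanishes, only g x
      = 0 remains.\<close>
    then have "1 \<bullet> (?g *\<^sub>R x + (a * (1 \<bullet> x)) *\<^sub>R 1) = 0"
      by simp
    then have "(?g + a * CARD('n)) * (1 \<bullet> x) = 0"
      by (simp add: inner_add_right one_inner_vec[of 1] algebra_simps)
    moreover have "?g + a * CARD('n) > 0"
      using a g by (simp add: add_pos_nonneg)
    ultimately have "1 \<bullet> x = 0"
      by (metis mult_eq_0_iff less_irrefl)
    with eq g show "x = 0" by simp
  qed
  then show ?thesis
    by (metis invertible_det_nz invertible_left_inverse matrix_left_invertible_ker)
qed

text \<open>The all-ones vector is an eigenvector of \<open>second_moment_Z\<close> with eigenvalue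
  g + a d, so \<open>t\<close> is the reciprocal of that eigenvalue.\<close>

lemma matrix_inv_second_moment_Z_one:
  assumes d: "CARD('n::finite) \<ge> 2"
  obtains t where "t > 0" and "matrix_inv second_moment_Z *v 1 = t *\<^sub>R (1 :: real ^ 'n)"
proof -
  let ?g = "separation_prob TYPE('n)"
  obtain a where a: "a \<ge> 0"
    and A: "\<And>x :: real ^ 'n. second_moment_Z *v x = ?g *\<^sub>R x + (a * (1 \<bullet> x)) *\<^sub>R 1"
    using second_moment_Z_mult_vector[OF d] by blast
  define t where "t = 1 / (?g + a * CARD('n))"
  have pos: "?g + a * CARD('n) > 0"
    using a separation_prob_pos[OF d] by (simp add: add_pos_nonneg)
  have "second_moment_Z *v (t *\<^sub>R 1) = (t * (?g + a * CARD('n))) *\<^sub>R (1 :: real ^ 'n)"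
    unfolding A by (simp add: one_inner_vec algebra_simps)
  then have "second_moment_Z *v (t *\<^sub>R 1) = (1 :: real ^ 'n)"
    using pos by (simp add: t_def)
  then have "matrix_inv second_moment_Z *v 1 = t *\<^sub>R (1 :: real ^ 'n)"
    unfolding matrix_inv_vector_cramer[OF det_second_moment_Z[OF d]]
    by (rule cramer[OF det_second_moment_Z[OF d], THEN iffD1, symmetric])
  moreover have "t > 0"
    using pos by (simp add: t_def)
  ultimately show thesis
    using that by blast
qed

text \<open>With y the inverse applied to \<open>c\<close>, the factor \<open>t\<close> cancels and
  the solution is y with its mean replaced by the prescribed one. Since \<open>c\<close> is g y plus
  a multiple of the all-ones vector, centering \<open>c\<close> gives g times the centered y, and
  \<open>a\<close> disappears.\<close>

lemma shap_solution_second_moment_Z: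
  fixes c :: "real ^ 'n::finite"
  assumes d: "CARD('n) \<ge> 2"
  shows "shap_solution v second_moment_Z c =
    (1 / separation_prob TYPE('n)) *\<^sub>R (c - ((1 \<bullet> c) / real CARD('n)) *\<^sub>R 1)
      + ((v UNIV - v {}) / real CARD('n)) *\<^sub>R 1"
proof -
  let ?g = "separation_prob TYPE('n)" and ?d = "real CARD('n)"
  obtain a where A: "\<And>x :: real ^ 'n. second_moment_Z *v x = ?g *\<^sub>R x + (a * (1 \<bullet> x)) *\<^sub>R 1"
    using second_moment_Z_mult_vector[OF d] by blast
  obtain t where "t > 0" and t: "matrix_inv second_moment_Z *v 1 = t *\<^sub>R (1 :: real ^ 'n)"
    using matrix_inv_second_moment_Z_one[OF d] by blast
  define y where "y = matrix_inv second_moment_Z *v c"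
  have "second_moment_Z *v y = c"
    by (simp add: y_def matrix_vector_mul_assoc matrix_inv_right[OF det_second_moment_Z[OF d]])
  then have c: "c = ?g *\<^sub>R y + (a * (1 \<bullet> y)) *\<^sub>R 1"
    by (simp add: A)
  have one: "1 \<bullet> (1 :: real ^ 'n) = ?d"
    by (simp add: one_inner_vec)
  have "1 \<bullet> c = ?g * (1 \<bullet> y) + a * (1 \<bullet> y) * ?d"
    by (subst c) (simp add: inner_add_right one)
  then have mean: "(1 \<bullet> c) / ?d = ?g * (1 \<bullet> y) / ?d + a * (1 \<bullet> y)"
    by (simp add: add_divide_distrib)
  have g: "?g > 0"
    by (rule separation_prob_pos[OF d])
  have "shap_solution v second_moment_Z c = y - (((1 \<bullet> y) - v UNIV + v {}) / ?d) *\<^sub>R 1"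
    using \<open>t > 0\<close>
    by (simp add: shap_solution_def matrix_vector_mult_diff_distrib matrix_vector_mult_scaleR
        y_def[symmetric] t one)
  also have "\<dots> = (1 / ?g) *\<^sub>R (c - ((1 \<bullet> c) / ?d) *\<^sub>R 1) + ((v UNIV - v {}) / ?d) *\<^sub>R 1"
    unfolding mean by (subst c) (use g in \<open>simp add: vec_eq_iff field_simps\<close>)
  finally show ?thesis .
qed

section \<open>Shapley values as the exact constrained solution\<close>

text \<open>The coefficient of \<open>v S\<close> in the Shapley value of player \<open>i\<close>.
  The truncated subtraction \<open>card S - 1\<close> is harmless, as it is used only when
  \<open>S\<close> contains \<open>i\<close>.\<close>

definition shapley_coeff :: "'n::finite \<Rightarrow> 'n set \<Rightarrow> real" where
  "shapley_coeff i S =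
    (if i \<in> S then inverse (real ((CARD('n) - 1) choose (card S - 1)))
     else - inverse (real ((CARD('n) - 1) choose card S))) / real CARD('n)"

lemma shapley_values_eq_sum_coeff:
  fixes v :: "'n::finite game"
  shows "shapley_values v $ i = (\<Sum>S\<in>UNIV. shapley_coeff i S * v S)"
proof -
  have "bij_betw (insert i) (Pow (UNIV - {i})) {S. i \<in> S}"
    by (rule bij_betw_byWitness[where f' = "\<lambda>S. S - {i}"]) auto
  then have "(\<Sum>S | i \<in> S. shapley_coeff i S * v S) =
      (\<Sum>S\<in>Pow (UNIV - {i}). shapley_coeff i (insert i S) * v (insert i S))"
    by (rule sum.reindex_bij_betw[symmetric])
  also have "\<dots> = (\<Sum>S\<in>Pow (UNIV - {i}).
      inverse (real ((CARD('n) - 1) choose card S)) * v (insert i S) / real CARD('n))"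
  proof (rule sum.cong[OF refl])
    fix S assume "S \<in> Pow (UNIV - {i})"
    then have "i \<notin> S" by auto
    then show "shapley_coeff i (insert i S) * v (insert i S) =
        inverse (real ((CARD('n) - 1) choose card S)) * v (insert i S) / real CARD('n)"
      by (simp add: shapley_coeff_def)
  qed
  finally have in_part: "(\<Sum>S | i \<in> S. shapley_coeff i S * v S) = \<dots>" .
  have "(\<Sum>S\<in>UNIV. shapley_coeff i S * v S) =
      (\<Sum>S | i \<in> S. shapley_coeff i S * v S) + (\<Sum>S | i \<notin> S. shapley_coeff i S * v S)"
    by (subst sum.union_disjoint[symmetric]) (auto intro: sum.cong)
  also have "{S. i \<notin> S} = Pow (UNIV - {i})"
    by auto
  also have "(\<Sum>S\<in>Pow (UNIV - {i}). shapley_coeff i S * v S) =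
      (\<Sum>S\<in>Pow (UNIV - {i}). - (inverse (real ((CARD('n) - 1) choose card S)) * v S / real CARD('n)))"
    by (rule sum.cong) (auto simp: shapley_coeff_def)
  finally show ?thesis
    unfolding in_part
    by (simp add: shapley_values_def sum_distrib_left sum.distrib[symmetric] diff_divide_distrib
        right_diff_distrib sum_subtractf sum_negf)
qed

text \<open>Here d / (d - 1) times the weight is the kernel probability of \<open>S\<close> divided
  by the separation probability, so the left side is the coefficient of \<open>v S\<close> in the
  centered c / g. The bracket cancels d - k or k from the weight, and an absorption identity for
  binomials does the rest.\<close>

lemma shapley_coeff_proper:
  fixes S :: "'n::finite set"
  assumes k: "0 < card S" "card S < CARD('n)"
  shows "real CARD('n) / (real CARD('n) - 1) * shapley_weight S *
    ((if i \<in> S then 1 else 0) - real (card S) / real CARD('n)) = shapley_coeff i S"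
proof -
  define d k where "d = CARD('n)" and "k = card S"
  have k: "0 < k" "k < d"
    using assms by (auto simp: d_def k_def)
  have d: "real d - 1 > 0" "real d - real k > 0"
    using k by auto
  have w: "shapley_weight S = (real d - 1) / (real (d choose k) * real k * (real d - real k))"
    using k by (simp add: shapley_weight_def d_def[symmetric] k_def[symmetric])
  have "k * (d choose k) = d * ((d - 1) choose (k - 1))"
    by (rule times_binomial_minus1_eq) fact
  then have 1: "real k * real (d choose k) = real d * real ((d - 1) choose (k - 1))"
    by (metis of_nat_mult)
  have "(d - k) * (d choose k) = d * ((d - 1) choose k)"
    by (rule binomial_absorb_comp)
  then have "real (d - k) * real (d choose k) = real d * real ((d - 1) choose k)"
    by (metis of_nat_mult)
  then have 2: "(real d - real k) * real (d choose k) = real d * real ((d - 1) choose k)"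
    using k by (simp add: of_nat_diff)
  have nz: "real (d choose k) \<noteq> 0"
    using k by simp
  show ?thesis
  proof (cases "i \<in> S")
    case True
    have "real d / (real d - 1) * shapley_weight S * (1 - real k / real d) =
        1 / (real k * real (d choose k))"
      unfolding w using k d nz by (simp add: divide_simps)
    also have "\<dots> = inverse (real ((d - 1) choose (k - 1))) / real d"
      unfolding 1 by (simp add: divide_simps)
    finally show ?thesis
      using True by (simp add: shapley_coeff_def d_def k_def)
  next
    case False
    have "real d / (real d - 1) * shapley_weight S * (0 - real k / real d) =
        - (1 / ((real d - real k) * real (d choose k)))"
      unfolding w using k d nz by (simp add: divide_simps)
    also have "\<dots> = - inverse (real ((d - 1) choose k)) / real d"
      unfolding 2 by (simp add: divide_simps)
    finally show ?thesis
      using False by (simp add: shapley_coeff_def d_def k_def)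
  qed
qed

lemma shapley_values_diff_const:
  "shapley_values (\<lambda>S. v S - r) = shapley_values v"
  by (simp add: shapley_values_def)

lemma shap_solution_exact:
  fixes v :: "'n::finite game"
  assumes d: "CARD('n) \<ge> 2"
  shows "shap_solution v second_moment_Z
    (measure_pmf.expectation shapley_kernel (\<lambda>S. (v S - v {}) *\<^sub>R indvec S)) = shapley_values v"
    (is "shap_solution v _ ?c = _")
proof -
  let ?d = "real CARD('n)" and ?W = "\<Sum>S\<in>UNIV. shapley_weight (S :: 'n set)"
  \<comment> \<open>Normalizing the game to vanish on the empty coalition leaves Shapley values
    unchanged and removes the empty coalition from the comparison of coefficients.\<close>
  define u where "u S = v S - v {}" for S
  have W: "?W > 0"
    by (rule sum_shapley_weight_pos[OF d])
  have c: "?c $ i = (\<Sum>S\<in>UNIV. pmf shapley_kernel S * u S * (if i \<in> S then 1 else 0))" for i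
    unfolding expectation_finite_pmf u_def
    by (simp add: indvec_def)
  have "1 \<bullet> ?c = (\<Sum>S\<in>UNIV. \<Sum>i\<in>UNIV. pmf shapley_kernel S * u S * (if i \<in> S then 1 else 0))"
    unfolding one_inner_vec c by (rule sum.swap)
  also have "\<dots> = (\<Sum>S\<in>UNIV. pmf shapley_kernel S * u S * real (card S))"
    by (simp add: sum_distrib_left[symmetric] flip: of_bool_def)
  finally have mean: "1 \<bullet> ?c = \<dots>" .
  have "shap_solution v second_moment_Z ?c $ i = shapley_values u $ i" for i
  proof -
    have "?c $ i - (1 \<bullet> ?c) / ?d = (\<Sum>S\<in>UNIV.
        pmf shapley_kernel S * u S * ((if i \<in> S then 1 else 0) - real (card S) / ?d))"
      unfolding mean c by (simp add: sum_divide_distrib sum_subtractf[symmetric] right_diff_distrib)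
    then have "(?c $ i - (1 \<bullet> ?c) / ?d) / separation_prob TYPE('n) = (\<Sum>S\<in>UNIV.
        pmf shapley_kernel S * u S * ((if i \<in> S then 1 else 0) - real (card S) / ?d)
          / separation_prob TYPE('n))"
      by (simp add: sum_divide_distrib)
    also have "\<dots> = (\<Sum>S\<in>UNIV. ?d / (?d - 1) * shapley_weight S *
        ((if i \<in> S then 1 else 0) - real (card S) / ?d) * u S)"
      using W d by (intro sum.cong refl)
        (simp add: pmf_shapley_kernel[OF d] separation_prob_def field_simps)
    finally have "shap_solution v second_moment_Z ?c $ i = (\<Sum>S\<in>UNIV. ?d / (?d - 1) *
        shapley_weight S * ((if i \<in> S then 1 else 0) - real (card S) / ?d) * u S) + u UNIV / ?d"
      by (simp add: shap_solution_second_moment_Z[OF d] u_def)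
    \<comment> \<open>The mean correction becomes the summand at \<open>UNIV\<close>. There the
      kernel weight is 0, so this term alone supplies the Shapley coefficient 1 / d.\<close>
    also have "\<dots> = (\<Sum>S\<in>UNIV. ?d / (?d - 1) * shapley_weight S *
        ((if i \<in> S then 1 else 0) - real (card S) / ?d) * u S + (if S = UNIV then u S / ?d else 0))"
      by (simp add: sum.distrib)
    also have "\<dots> = (\<Sum>S\<in>UNIV. shapley_coeff i S * u S)"
    proof (rule sum.cong[OF refl])
      fix S :: "'n set"
      consider "S = {}" | "S = UNIV" | "S \<noteq> UNIV" "0 < card S" "card S < CARD('n)"
        by (metis card_gt_0_iff finite psubset_card_mono top.not_eq_extremum)
      then show "?d / (?d - 1) * shapley_weight S *
          ((if i \<in> S then 1 else 0) - real (card S) / ?d) * u S + (if S = UNIV then u S / ?d else 0)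
          = shapley_coeff i S * u S"
      proof cases
        case 3
        then show ?thesis by (simp only: shapley_coeff_proper if_False add_0_right)
      qed (auto simp: u_def shapley_weight_def shapley_coeff_def)
    qed
    finally show ?thesis
      by (simp add: shapley_values_eq_sum_coeff)
  qed
  then have "shap_solution v second_moment_Z ?c = shapley_values u"
    by (simp add: vec_eq_iff)
  then show ?thesis
    by (simp add: u_def[abs_def] shapley_values_diff_const)
qed

section \<open>Consistency and unbiasedness of the estimators\<close>

theorem mainTheorem2:
  fixes v :: "'n::finite game"
    and M :: "'a measure"
    and Z :: "nat \<Rightarrow> 'a \<Rightarrow> 'n set"
  assumes "CARD('n) \<ge> 2"
    and "prob_space M"
    and "prob_space.indep_vars M (\<lambda>_. count_space UNIV) Z UNIV"
    and "\<And>i. distr M (count_space UNIV) (Z i) = measure_pmf shapley_kernel"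
  shows "(bounded (range v) \<longrightarrow>
           (AE \<omega> in M. (\<lambda>n. beta_hat v (\<lambda>i. Z i \<omega>) n) \<longlonglongrightarrow> shapley_values v) \<and>
           (AE \<omega> in M. (\<lambda>n. beta_bar v (\<lambda>i. Z i \<omega>) n) \<longlonglongrightarrow> shapley_values v)) \<and>
         (\<forall>n\<ge>1. integrable M (\<lambda>\<omega>. beta_bar v (\<lambda>i. Z i \<omega>) n) \<and>
           integral\<^sup>L M (\<lambda>\<omega>. beta_bar v (\<lambda>i. Z i \<omega>) n) = shapley_values v)"
proof -
  note d = assms(1)
  interpret prob_space M by fact
  let ?E = "measure_pmf.expectation (shapley_kernel :: 'n set pmf)"
  let ?A = "second_moment_Z :: real ^ 'n ^ 'n"
  define c where "c = ?E (\<lambda>S. (v S - v {}) *\<^sub>R indvec S)"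
  \<comment> \<open>Both \<open>b_hat\<close> and \<open>b_bar\<close> converge to \<open>c\<close>;
    this form matches \<open>b_bar\<close>, whose second term is already an exact
    expectation.\<close>
  have c_eq: "c = ?E (\<lambda>S. v S *\<^sub>R indvec S) - v {} *\<^sub>R mean_Z"
    by (simp add: c_def mean_Z_def expectation_finite_pmf scaleR_diff_left scaleR_diff_right
        sum_subtractf scaleR_sum_right mult.commute)
  have exact: "shap_solution v ?A c = shapley_values v"
    unfolding c_def by (rule shap_solution_exact[OF d])
  have rv: "Z i \<in> measurable M (count_space UNIV)" for i
    using assms(3) unfolding indep_vars_def by blast
  note slln = strong_law_finite[OF assms(3,4)]

  obtain t where "t > 0" and t: "matrix_inv ?A *v 1 = t *\<^sub>R 1"
    using matrix_inv_second_moment_Z_one[OF d] by blast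
  then have nz: "1 \<bullet> (matrix_inv ?A *v 1) \<noteq> 0"
    by (simp add: one_inner_vec)
  note cont = tendsto_shap_solution[OF _ _ det_second_moment_Z[OF d] nz, of _ _ _ c v,
      unfolded exact]

  have hat: "AE \<omega> in M. (\<lambda>n. beta_hat v (\<lambda>i. Z i \<omega>) n) \<longlonglongrightarrow> shapley_values v"
    using slln[of "\<lambda>S. outer (indvec S) (indvec S)"] slln[of "\<lambda>S. (v S - v {}) *\<^sub>R indvec S"]
  proof eventually_elim
    case (elim \<omega>)
    then show ?case
      unfolding beta_hat_def A_hat_def b_hat_def
      by (intro cont) (simp_all add: second_moment_Z_def c_def)
  qed
  have bar: "AE \<omega> in M. (\<lambda>n. beta_bar v (\<lambda>i. Z i \<omega>) n) \<longlonglongrightarrow> shapley_values v"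
    using slln[of "\<lambda>S. v S *\<^sub>R indvec S"]
  proof eventually_elim
    case (elim \<omega>)
    then show ?case
      unfolding beta_bar_def b_bar_def
      by (intro cont tendsto_const) (simp add: c_eq tendsto_diff)
  qed

  have unbiased: "integrable M (\<lambda>\<omega>. beta_bar v (\<lambda>i. Z i \<omega>) n) \<and>
      integral\<^sup>L M (\<lambda>\<omega>. beta_bar v (\<lambda>i. Z i \<omega>) n) = shapley_values v" if "n \<ge> 1" for n
  proof -
    let ?b = "\<lambda>\<omega>. b_bar v (\<lambda>i. Z i \<omega>) n"
    \<comment> \<open>For the exact matrix the solution map is affine: \<open>L\<close> is its
      linear part and \<open>r\<close> its constant part. A bounded linear map commutes with the
      integral, so the mean of \<open>beta_bar\<close> is the solution at the mean of
      \<open>b_bar\<close>.\<close>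
    define L where "L x = (1 / separation_prob TYPE('n)) *\<^sub>R
      (x - ((1 \<bullet> x) / real CARD('n)) *\<^sub>R 1)" for x :: "real ^ 'n"
    define r where "r = ((v UNIV - v {}) / real CARD('n)) *\<^sub>R (1 :: real ^ 'n)"
    have L: "bounded_linear L"
      unfolding L_def
      by (rule linear_conv_bounded_linear[THEN iffD1], rule linearI)
         (simp_all add: inner_add_right algebra_simps add_divide_distrib)
    have sol: "shap_solution v ?A x = L x + r" for x
      by (simp add: shap_solution_second_moment_Z[OF d] L_def r_def)
    note int = integral_pmf_distr[OF rv assms(4), of "\<lambda>S. v S *\<^sub>R indvec S"]
    have b: "integrable M ?b"
      unfolding b_bar_def using int(1) by simp
    have "integral\<^sup>L M ?b = c"
      \<comment> \<open>The sample average has mean E[v(Z) Z] only for n at least 1; for n = 0 it is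
        the zero vector.\<close>
      unfolding b_bar_def c_eq using int that
      by (simp add: prob_space sum_constant_scaleR del: sum_constant)
    then show ?thesis
      using integrable_bounded_linear[OF L b] integral_bounded_linear[OF L b] exact
      by (simp add: beta_bar_def sol prob_space)
  qed
  show ?thesis
    using hat bar unbiased by blast
qed

end
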